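(* For a positive integer $n$, let $N(2n)$ be the number of distinct $S(3,\{4,6\},2n)$ designs on a fixed $2n$-element point set. There is a constant $c>0$ such that $\ln N(2n)> c\, n^3\ln n$ for all sufficiently large $n$.
   Context: An $S(3,\{4,6\},v)$ is a pair $(X,B)$ with $|X|=v$ and $B$ a set of subsets of $X$ each of size $4$ or $6$, such that every $3$-element subset of $X$ is contained in exactly one member of $B$. *)

theory Defs
  imports Complex_Main
begin

definition is_S3_46 :: "'a set \<Rightarrow> 'a set set \<Rightarrow> bool" where
  "is_S3_46 X B \<longleftrightarrow>
     (\<forall>b\<in>B. b \<subseteq> X \<and> (card b = 4 \<or> card b = 6)) \<and>
     (\<forall>T. T \<subseteq> X \<and> card T = 3 \<longrightarrow> (\<exists>!b. b \<in> B \<and> T \<subseteq> b))"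

definition num_S3_46 :: "nat \<Rightarrow> nat" where
  "num_S3_46 v = card {B. is_S3_46 {0..<v} B}"

end

theory Submission
  imports Defs
begin

text \<open>
  Every design on \<open>u\<close> points yields one on \<open>2 * u\<close> points and, by deleting a point first, one on
  \<open>2 * u - 2\<close> points: each point is doubled, each block is replaced by a transversal design on the
  doubled block, and the triples containing a doubled point are covered by small designs. For even
  \<open>u\<close> this reaches all even orders. A transversal design on a doubled block of size 4 consists of
  the transversals of even parity, so iterating the constructions from a single block of size 4
  produces, for some \<open>m = 2 ^ e\<close> with \<open>4 * m < v \<le> 12 * m\<close>, a design on \<open>v\<close> points that contains
  all blocks \<open>{x, m + y, 2 * m + z, 3 * m + f x y z}\<close> where \<open>f\<close> is the bitwise exclusive or of the
  three coordinates.

  Any other Latin cube may be substituted for \<open>f\<close>. Adding a constant \<open>c\<close> to \<open>f\<close> on a subcube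
  \<open>{x, xor x c} \<times> {y, xor y c} \<times> {z, xor z c}\<close> keeps it Latin, and this can be done
  independently on disjoint subcubes. Choosing about \<open>m ^ 3 / 128\<close> of them greedily gives at least
  \<open>m ^ (m ^ 3 div 128)\<close> different Latin cubes.
\<close>

subsection \<open>Doubling the points\<close>

text \<open>The copies of \<open>y\<close> are \<open>2 * y\<close> and \<open>2 * y + 1\<close>, so
  \<open>p div 2\<close> is the projection, and an initial segment doubles to an initial
  segment.\<close>

definition dbl :: "nat set \<Rightarrow> nat set" where
  "dbl c = {p. p div 2 \<in> c}"

text \<open>The groups of a doubled point set are the pairs \<open>{2 * y, 2 * y + 1}\<close>.\<close>

definition transversal :: "nat set \<Rightarrow> bool" where
  "transversal T \<longleftrightarrow> inj_on (\<lambda>p. p div 2) T"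

text \<open>A group divisible 3-design with groups of size 2. Blocks may miss groups: over six
  groups, most blocks of \<open>td6\<close> have size 4.\<close>

definition transversal_design :: "nat set \<Rightarrow> nat set set \<Rightarrow> bool" where
  "transversal_design b H \<longleftrightarrow>
     (\<forall>h\<in>H. h \<subseteq> dbl b \<and> (card h = 4 \<or> card h = 6) \<and> transversal h) \<and>
     (\<forall>T. T \<subseteq> dbl b \<and> card T = 3 \<and> transversal T \<longrightarrow> (\<exists>!h. h \<in> H \<and> T \<subseteq> h))"

lemma dbl_mono: "a \<subseteq> b \<Longrightarrow> dbl a \<subseteq> dbl b"
  by (auto simp: dbl_def)

lemma subset_dbl_iff: "T \<subseteq> dbl c \<longleftrightarrow> (\<lambda>p. p div 2) ` T \<subseteq> c"
  by (auto simp: dbl_def)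

lemma dbl_atLeastLessThan: "dbl {0..<u} = {0..<2 * u}"
  by (auto simp: dbl_def)

lemma dbl_eq_image: "dbl c = (\<lambda>y. 2 * y) ` c \<union> (\<lambda>y. 2 * y + 1) ` c"
proof -
  have "p \<in> (\<lambda>y. 2 * y) ` c \<union> (\<lambda>y. 2 * y + 1) ` c" if "p div 2 \<in> c" for p
  proof (cases "even p")
    case True
    then show ?thesis using that by (metis UnI1 dvd_mult_div_cancel image_eqI)
  next
    case False
    then show ?thesis using that by (metis UnI2 odd_two_times_div_two_succ image_eqI)
  qed
  then show ?thesis by (auto simp: dbl_def)
qed

lemma card_dbl: assumes "finite c" shows "card (dbl c) = 2 * card c"
proof -
  have "(\<lambda>y. 2 * y) ` c \<inter> (\<lambda>y. 2 * y + 1) ` c = {}"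
    by (auto; presburger)
  then show ?thesis
    unfolding dbl_eq_image using assms
    by (simp add: card_Un_disjoint card_image inj_on_def)
qed

lemma finite_dbl: "finite c \<Longrightarrow> finite (dbl c)"
  by (simp add: dbl_eq_image)

lemma transversal_subset: "transversal h \<Longrightarrow> T \<subseteq> h \<Longrightarrow> transversal T"
  unfolding transversal_def by (rule inj_on_subset)

text \<open>Fibres of halving have at most 2 points, so three points have at least 2 images;
  non-injectivity excludes 3.\<close>

lemma card_half_image_not_transversal:
  assumes "card T = 3" "\<not> transversal T"
  shows "card ((\<lambda>p::nat. p div 2) ` T) = 2"
proof -
  let ?t = "(\<lambda>p::nat. p div 2) ` T"
  have fin: "finite T" using assms(1) by (metis card.infinite zero_neq_numeral)
  have "card ?t \<noteq> 3"
    using assms fin unfolding transversal_def by (metis eq_card_imp_inj_on)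
  moreover have "card ?t \<le> 3" using assms fin by (metis card_image_le)
  moreover have "card T \<le> card (dbl ?t)"
    using fin by (intro card_mono finite_dbl) (auto simp: dbl_def)
  then have "3 \<le> 2 * card ?t" using fin assms by (simp add: card_dbl)
  ultimately show ?thesis by linarith
qed

lemma transversal_design_block:
  "transversal_design b H \<Longrightarrow> h \<in> H \<Longrightarrow> h \<subseteq> dbl b \<and> (card h = 4 \<or> card h = 6) \<and> transversal h"
  unfolding transversal_design_def by blast

lemma transversal_design_ex1:
  "transversal_design b H \<Longrightarrow> T \<subseteq> dbl b \<Longrightarrow> card T = 3 \<Longrightarrow> transversal T \<Longrightarrow> \<exists>!h. h \<in> H \<and> T \<subseteq> h"
  unfolding transversal_design_def by simp

lemma is_S3_46_block: "is_S3_46 X B \<Longrightarrow> b \<in> B \<Longrightarrow> b \<subseteq> X \<and> (card b = 4 \<or> card b = 6)"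
  unfolding is_S3_46_def by blast

lemma is_S3_46_ex1: "is_S3_46 X B \<Longrightarrow> T \<subseteq> X \<Longrightarrow> card T = 3 \<Longrightarrow> \<exists>!b. b \<in> B \<and> T \<subseteq> b"
  unfolding is_S3_46_def by simp

text \<open>
  A triple meeting three groups projects to a triple of \<open>Y\<close>, and one containing a whole group
  projects to a pair; so triples of \<open>Y\<close> must be covered by \<open>BB \<union> CC\<close>, pairs by \<open>CC\<close> alone.
\<close>

lemma doubling:
  assumes BB: "\<And>b. b \<in> BB \<Longrightarrow> b \<subseteq> Y \<and> transversal_design b (H b)"
    and CC: "\<And>c. c \<in> CC \<Longrightarrow> c \<subseteq> Y \<and> is_S3_46 (dbl c) (G c)"
    and disj: "BB \<inter> CC = {}"
    and pairs: "\<And>P. P \<subseteq> Y \<Longrightarrow> card P = 2 \<Longrightarrow> \<exists>!c. c \<in> CC \<and> P \<subseteq> c"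
    and triples: "\<And>T. T \<subseteq> Y \<Longrightarrow> card T = 3 \<Longrightarrow> \<exists>!b. b \<in> BB \<union> CC \<and> T \<subseteq> b"
  shows "is_S3_46 (dbl Y) ((\<Union>b\<in>BB. H b) \<union> (\<Union>c\<in>CC. G c))"
    (is "is_S3_46 _ ?D")
  unfolding is_S3_46_def
proof (intro conjI ballI allI impI)
  fix h assume "h \<in> ?D"
  then consider b where "b \<in> BB" "h \<in> H b" | c where "c \<in> CC" "h \<in> G c" by blast
  then have "\<exists>b\<subseteq>Y. h \<subseteq> dbl b \<and> (card h = 4 \<or> card h = 6)"
  proof cases
    case (1 b)
    show ?thesis
      using BB[OF 1(1)] transversal_design_block[of b "H b" h] 1(2) by (intro exI[of _ b]) simp
  next
    case (2 c)
    show ?thesis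
      using CC[OF 2(1)] is_S3_46_block[of "dbl c" "G c" h] 2(2) by (intro exI[of _ c]) simp
  qed
  then obtain b where b: "b \<subseteq> Y" "h \<subseteq> dbl b" "card h = 4 \<or> card h = 6" by blast
  show "h \<subseteq> dbl Y" using b dbl_mono by blast
  show "card h = 4 \<or> card h = 6" by (rule b)
next
  fix T assume T: "T \<subseteq> dbl Y \<and> card T = 3"
  define t where "t = (\<lambda>p::nat. p div 2) ` T"
  have dbl_iff: "T \<subseteq> dbl c \<longleftrightarrow> t \<subseteq> c" for c
    unfolding t_def by (rule subset_dbl_iff)
  have tY: "t \<subseteq> Y" using T by (simp add: dbl_iff)
  have HB: "t \<subseteq> b" if "b \<in> BB" "h \<in> H b" "T \<subseteq> h" for b h
  proof -
    have "h \<subseteq> dbl b" using BB[OF that(1)] transversal_design_block that(2) by blast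
    then show ?thesis using that(3) dbl_iff by blast
  qed
  have GC: "t \<subseteq> c" if "c \<in> CC" "h \<in> G c" "T \<subseteq> h" for c h
  proof -
    have "h \<subseteq> dbl c" using CC[OF that(1)] is_S3_46_block that(2) by blast
    then show ?thesis using that(3) dbl_iff by blast
  qed
  show "\<exists>!h. h \<in> ?D \<and> T \<subseteq> h"
  proof (cases "transversal T")
    case True
    then have "card t = 3" using T unfolding transversal_def t_def by (simp add: card_image)
    from triples[OF tY this] obtain b where b: "b \<in> BB \<union> CC" "t \<subseteq> b"
      and uniq: "\<And>b'. b' \<in> BB \<union> CC \<Longrightarrow> t \<subseteq> b' \<Longrightarrow> b' = b" by blast
    show ?thesis
    proof (cases "b \<in> BB")
      case bB: True
      have "\<exists>!h. h \<in> H b \<and> T \<subseteq> h"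
        by (rule transversal_design_ex1[of b]) (use BB[OF bB] b T True in \<open>simp_all add: dbl_iff\<close>)
      \<comment> \<open>A block through \<open>T\<close> comes from a base block containing
        \<open>t\<close>, hence from \<open>b\<close>; \<open>disj\<close> keeps \<open>b\<close>
        from contributing a second ingredient.\<close>
      moreover have "h \<in> ?D \<and> T \<subseteq> h \<longleftrightarrow> h \<in> H b \<and> T \<subseteq> h" for h
        using HB[of _ h] GC[of _ h] uniq bB disj by blast
      ultimately show ?thesis by simp
    next
      case False
      then have bC: "b \<in> CC" using b by blast
      have "\<exists>!h. h \<in> G b \<and> T \<subseteq> h"
        by (rule is_S3_46_ex1[of "dbl b"]) (use CC[OF bC] b T in \<open>simp_all add: dbl_iff\<close>)
      moreover have "h \<in> ?D \<and> T \<subseteq> h \<longleftrightarrow> h \<in> G b \<and> T \<subseteq> h" for h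
        using HB[of _ h] GC[of _ h] uniq bC False by blast
      ultimately show ?thesis by simp
    qed
  next
    case False
    then have "card t = 2" using T card_half_image_not_transversal unfolding t_def by blast
    from pairs[OF tY this] obtain c where c: "c \<in> CC" "t \<subseteq> c"
      and uniq: "\<And>c'. c' \<in> CC \<Longrightarrow> t \<subseteq> c' \<Longrightarrow> c' = c" by blast
    have "\<exists>!h. h \<in> G c \<and> T \<subseteq> h"
      by (rule is_S3_46_ex1[of "dbl c"]) (use CC[OF c(1)] c T in \<open>simp_all add: dbl_iff\<close>)
    \<comment> \<open>Ingredients over \<open>BB\<close> have transversal blocks, which never
      contain a whole group.\<close>
    moreover have "\<not> T \<subseteq> h" if "b \<in> BB" "h \<in> H b" for b h
    proof -
      have "transversal h" using BB[OF that(1)] transversal_design_block that(2) by blast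
      then show ?thesis using False transversal_subset by blast
    qed
    then have "h \<in> ?D \<and> T \<subseteq> h \<longleftrightarrow> h \<in> G c \<and> T \<subseteq> h" for h
      using GC[of _ h] uniq c(1) by blast
    ultimately show ?thesis by simp
  qed
qed

subsection \<open>Small ingredients\<close>

lemma card_3_less_obtain:
  assumes "T \<subseteq> {0..<v::nat}" "card T = 3"
  obtains a b c where "a \<in> set [0..<v]" "b \<in> set [0..<v]" "c \<in> set [0..<v]"
    "a \<noteq> b" "a \<noteq> c" "b \<noteq> c" "T = {a, b, c}"
  using assms unfolding card_3_iff by force

text \<open>Turns the counting checks run by \<open>code_simp\<close> into unique existence.\<close>

lemma ex1_list_filter:
  assumes "length (filter P xs) = 1"
  shows "\<exists>!x. x \<in> set xs \<and> P x"
proof -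
  obtain x where x: "filter P xs = [x]" using assms by (auto simp: length_Suc_conv)
  then have "y \<in> set xs \<and> P y \<longleftrightarrow> y = x" for y
    using set_filter[of P xs] unfolding x by auto
  then show ?thesis by simp
qed

text \<open>
  The orbits of \<open>{0, 1, 3, 4}\<close>, \<open>{0, 1, 2, 6}\<close> and \<open>{0, 2, 4, 7}\<close> under translation modulo 10,
  after the relabelling \<open>2 \<mapsto> 4 \<mapsto> 3 \<mapsto> 2\<close>, which turns the first block into \<open>{0, 1, 2, 3}\<close>.
\<close>

definition sqs10 :: "nat list list" where
  "sqs10 = [[0, 1, 2, 3], [0, 1, 4, 6], [0, 1, 5, 9], [0, 1, 7, 8], [0, 2, 4, 9], [0, 2, 5, 7],
    [0, 2, 6, 8], [0, 3, 4, 7], [0, 3, 5, 6], [0, 3, 8, 9], [0, 4, 5, 8], [0, 6, 7, 9],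
    [1, 2, 4, 7], [1, 2, 5, 8], [1, 2, 6, 9], [1, 3, 4, 5], [1, 3, 6, 8], [1, 3, 7, 9],
    [1, 4, 8, 9], [1, 5, 6, 7], [2, 3, 4, 8], [2, 3, 5, 9], [2, 3, 6, 7], [2, 4, 5, 6],
    [2, 7, 8, 9], [3, 4, 6, 9], [3, 5, 7, 8], [4, 5, 7, 9], [4, 6, 7, 8], [5, 6, 8, 9]]"

lemma sqs10_check:
  "\<forall>a\<in>set [0..<10]. \<forall>b\<in>set [0..<10]. \<forall>c\<in>set [0..<10]. a \<noteq> b \<longrightarrow> a \<noteq> c \<longrightarrow> b \<noteq> c \<longrightarrow>
     length (filter (\<lambda>l. a \<in> set l \<and> b \<in> set l \<and> c \<in> set l) sqs10) = 1"
  by code_simp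

lemma sqs10_blocks: "\<forall>l\<in>set sqs10. distinct l \<and> length l = 4 \<and> (\<forall>x\<in>set l. x < 10)"
  by code_simp

section \<open>Transport of designs along injections\<close>

lemma ex1_image_superset:
  assumes inj: "inj_on f X" and B: "\<And>b. b \<in> B \<Longrightarrow> b \<subseteq> X" and T: "T \<subseteq> X"
    and ex1: "\<exists>!b. b \<in> B \<and> T \<subseteq> b"
  shows "\<exists>!b. b \<in> (`) f ` B \<and> f ` T \<subseteq> b"
proof -
  \<comment> \<open>\<open>f\<close> is injective on a set containing \<open>T\<close> and every
    block, so it reflects inclusions between them.\<close>
  have iff: "f ` T \<subseteq> f ` b \<longleftrightarrow> T \<subseteq> b" if "b \<in> B" for b
  proof
    assume sub: "f ` T \<subseteq> f ` b"
    show "T \<subseteq> b"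
    proof
      fix x assume x: "x \<in> T"
      then have "f x \<in> f ` b" using sub by blast
      then show "x \<in> b" using inj_on_image_mem_iff[OF inj _ B[OF that]] x T by blast
    qed
  qed blast
  from ex1 obtain b where b: "b \<in> B \<and> T \<subseteq> b" "\<forall>b'. b' \<in> B \<and> T \<subseteq> b' \<longrightarrow> b' = b"
    by (rule ex1E)
  show ?thesis
  proof (rule ex1I[of _ "f ` b"])
    show "f ` b \<in> (`) f ` B \<and> f ` T \<subseteq> f ` b" using b by blast
    fix c assume c: "c \<in> (`) f ` B \<and> f ` T \<subseteq> c"
    then obtain b' where b': "b' \<in> B" "c = f ` b'" by blast
    then have "b' = b" using c b(2) iff by simp
    then show "c = f ` b" using b' by simp
  qed
qed

lemma is_S3_46_image:
  assumes S: "is_S3_46 X B" and inj: "inj_on f X"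
  shows "is_S3_46 (f ` X) ((`) f ` B)"
  unfolding is_S3_46_def
proof (intro conjI ballI allI impI)
  fix c assume "c \<in> (`) f ` B"
  then obtain b where b: "b \<in> B" "c = f ` b" by blast
  have bX: "b \<subseteq> X" using is_S3_46_block[OF S b(1)] by simp
  show "c \<subseteq> f ` X" using b(2) bX by blast
  show "card c = 4 \<or> card c = 6"
    using is_S3_46_block[OF S b(1)] b(2) card_image[OF inj_on_subset[OF inj bX]] by simp
next
  fix T' assume T': "T' \<subseteq> f ` X \<and> card T' = 3"
  then obtain T where T: "T \<subseteq> X" "T' = f ` T" by (auto simp: subset_image_iff)
  then have "card T = 3" using T' card_image[OF inj_on_subset[OF inj T(1)]] by simp
  then have "\<exists>!b. b \<in> B \<and> T \<subseteq> b" by (rule is_S3_46_ex1[OF S T(1)])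
  then show "\<exists>!b. b \<in> (`) f ` B \<and> T' \<subseteq> b"
    unfolding T(2) using is_S3_46_block[OF S] by (intro ex1_image_superset[OF inj _ T(1)]) simp_all
qed

text \<open>\<open>g\<close> acts as \<open>f\<close> on groups and keeps the parity bit, so it maps
  groups to groups and respects transversality.\<close>

lemma transversal_design_image:
  assumes H: "transversal_design b H" and inj: "inj_on f b"
  defines "g \<equiv> \<lambda>p. 2 * f (p div 2) + p mod 2"
  shows "transversal_design (f ` b) ((`) g ` H)"
proof -
  have g_div: "g p div 2 = f (p div 2)" and g_mod: "g p mod 2 = p mod 2" for p
    by (simp_all add: g_def)
  have ginj: "inj_on g (dbl b)"
  proof (rule inj_onI)
    fix p q assume "p \<in> dbl b" "q \<in> dbl b" "g p = g q"
    then have "f (p div 2) = f (q div 2)" "p mod 2 = q mod 2" "p div 2 \<in> b" "q div 2 \<in> b"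
      using g_div g_mod by (metis, metis, simp_all add: dbl_def)
    then have "p div 2 = q div 2" "p mod 2 = q mod 2" using inj by (auto dest: inj_onD)
    then show "p = q" by (metis div_mult_mod_eq)
  qed
  have gim: "g ` dbl b = dbl (f ` b)"
  proof
    show "g ` dbl b \<subseteq> dbl (f ` b)" using g_div by (auto simp: dbl_def)
    show "dbl (f ` b) \<subseteq> g ` dbl b"
    proof
      fix q assume "q \<in> dbl (f ` b)"
      then obtain y where y: "y \<in> b" "q div 2 = f y" by (auto simp: dbl_def)
      have "g (2 * y + q mod 2) = q" using y(2) by (simp add: g_def) presburger
      moreover have "2 * y + q mod 2 \<in> dbl b" using y(1) by (simp add: dbl_def)
      ultimately show "q \<in> g ` dbl b" by (metis image_eqI)
    qed
  qed
  have trans: "transversal (g ` T) \<longleftrightarrow> transversal T" if "T \<subseteq> dbl b" for T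
  proof -
    have "transversal (g ` T) \<longleftrightarrow> inj_on ((\<lambda>p. p div 2) \<circ> g) T"
      unfolding transversal_def using comp_inj_on_iff[OF inj_on_subset[OF ginj that]] by metis
    also have "(\<lambda>p. p div 2) \<circ> g = f \<circ> (\<lambda>p. p div 2)" using g_div by auto
    also have "inj_on \<dots> T \<longleftrightarrow> transversal T"
    proof -
      have "inj_on f ((\<lambda>p. p div 2) ` T)"
        by (rule inj_on_subset[OF inj]) (use that in \<open>auto simp: dbl_def\<close>)
      then show ?thesis unfolding transversal_def
        using comp_inj_on inj_on_imageI2 by blast
    qed
    finally show ?thesis .
  qed
  show ?thesis
    unfolding transversal_design_def
  proof (intro conjI ballI allI impI)
    fix c assume "c \<in> (`) g ` H"
    then obtain h where h: "h \<in> H" "c = g ` h" by blast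
    have hb: "h \<subseteq> dbl b" "card h = 4 \<or> card h = 6" "transversal h"
      using transversal_design_block[OF H h(1)] by simp_all
    show "c \<subseteq> dbl (f ` b)" unfolding gim[symmetric] using h(2) hb(1) by blast
    show "card c = 4 \<or> card c = 6"
      using hb h(2) card_image[OF inj_on_subset[OF ginj hb(1)]] by simp
    show "transversal c" using hb h(2) trans by simp
  next
    fix T' assume T': "T' \<subseteq> dbl (f ` b) \<and> card T' = 3 \<and> transversal T'"
    then obtain T where T: "T \<subseteq> dbl b" "T' = g ` T"
      unfolding gim[symmetric] by (auto simp: subset_image_iff)
    then have "card T = 3" "transversal T"
      using T' trans card_image[OF inj_on_subset[OF ginj T(1)]] by simp_all
    then have "\<exists>!h. h \<in> H \<and> T \<subseteq> h" by (rule transversal_design_ex1[OF H T(1)])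
    then show "\<exists>!h. h \<in> (`) g ` H \<and> T' \<subseteq> h"
      unfolding T(2) using transversal_design_block[OF H]
      by (intro ex1_image_superset[OF ginj _ T(1)]) simp_all
  qed
qed

lemma is_S3_46_sqs10: "is_S3_46 {0..<10} (set ` set sqs10)"
  unfolding is_S3_46_def
proof (intro conjI ballI allI impI)
  fix b assume "b \<in> set ` set sqs10"
  then obtain l where l: "l \<in> set sqs10" "b = set l" by blast
  show "b \<subseteq> {0..<10}" "card b = 4 \<or> card b = 6"
    using sqs10_blocks l by (auto simp: distinct_card)
next
  fix T :: "nat set" assume T: "T \<subseteq> {0..<10} \<and> card T = 3"
  then obtain a b c where abc: "a \<in> set [0..<10]" "b \<in> set [0..<10]" "c \<in> set [0..<10]"
    "a \<noteq> b" "a \<noteq> c" "b \<noteq> c" "T = {a, b, c}" using card_3_less_obtain by blast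
  have "length (filter (\<lambda>l. a \<in> set l \<and> b \<in> set l \<and> c \<in> set l) sqs10) = 1"
    using sqs10_check abc(1-6) by blast
  from ex1_list_filter[OF this] have "\<exists>!l. l \<in> set sqs10 \<and> T \<subseteq> set l"
    unfolding abc(7) by simp
  then show "\<exists>!b. b \<in> set ` set sqs10 \<and> T \<subseteq> b" by blast
qed

section \<open>A transversal design on six groups\<close>

text \<open>
  Encode a transversal of the groups as a partial 0-1 labelling of 6 points. The two blocks of size 6
  are the constant labellings and cover the constant triples. For the others take a one-factorization
  of the complete graph on 6 points: two distinct edges of one factor, labelled 0 and 1
  respectively, form a block, and there are 5 * 6 of these.
\<close>

definition td6 :: "nat list list" where
  "td6 = [[0, 2, 4, 6, 8, 10], [1, 3, 5, 7, 9, 11],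
    [0, 3, 9, 10], [0, 5, 7, 10], [1, 2, 8, 11], [2, 5, 7, 8], [1, 4, 6, 11], [3, 4, 6, 9],
    [1, 2, 5, 10], [2, 7, 9, 10], [0, 3, 4, 11], [0, 4, 7, 9], [3, 6, 8, 11], [1, 5, 6, 8],
    [3, 4, 7, 10], [1, 4, 9, 10], [2, 5, 6, 11], [1, 2, 6, 9], [0, 5, 8, 11], [0, 3, 7, 8],
    [5, 6, 9, 10], [1, 3, 6, 10], [4, 7, 8, 11], [1, 3, 4, 8], [0, 2, 7, 11], [0, 2, 5, 9],
    [1, 7, 8, 10], [3, 5, 8, 10], [0, 6, 9, 11], [0, 3, 5, 6], [2, 4, 9, 11], [1, 2, 4, 7]]"

lemma td6_check:
  "\<forall>a\<in>set [0..<12]. \<forall>b\<in>set [0..<12]. \<forall>c\<in>set [0..<12].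
     a div 2 \<noteq> b div 2 \<longrightarrow> a div 2 \<noteq> c div 2 \<longrightarrow> b div 2 \<noteq> c div 2 \<longrightarrow>
     length (filter (\<lambda>l. a \<in> set l \<and> b \<in> set l \<and> c \<in> set l) td6) = 1"
  by code_simp

lemma td6_blocks:
  "\<forall>l\<in>set td6. distinct l \<and> (length l = 4 \<or> length l = 6) \<and> (\<forall>x\<in>set l. x < 12) \<and>
     distinct (map (\<lambda>p. p div 2) l)"
  by code_simp

lemma transversal_design_td6: "transversal_design {0..<6} (set ` set td6)"
  unfolding transversal_design_def dbl_atLeastLessThan
proof (intro conjI ballI allI impI)
  fix b assume "b \<in> set ` set td6"
  then obtain l where l: "l \<in> set td6" "b = set l" by blast
  show "b \<subseteq> {0..<2 * 6}" "card b = 4 \<or> card b = 6"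
    using td6_blocks l by (auto simp: distinct_card)
  show "transversal b" using td6_blocks l by (simp add: transversal_def distinct_map)
next
  fix T :: "nat set" assume T: "T \<subseteq> {0..<2 * 6} \<and> card T = 3 \<and> transversal T"
  then have "T \<subseteq> {0..<12}" by simp
  then obtain a b c where abc: "a \<in> set [0..<12]" "b \<in> set [0..<12]" "c \<in> set [0..<12]"
    "a \<noteq> b" "a \<noteq> c" "b \<noteq> c" "T = {a, b, c}" using T card_3_less_obtain by blast
  then have "a div 2 \<noteq> b div 2" "a div 2 \<noteq> c div 2" "b div 2 \<noteq> c div 2"
    using T unfolding transversal_def inj_on_def by blast+
  then have "length (filter (\<lambda>l. a \<in> set l \<and> b \<in> set l \<and> c \<in> set l) td6) = 1"
    using td6_check abc(1-3) by blast
  from ex1_list_filter[OF this] have "\<exists>!l. l \<in> set td6 \<and> T \<subseteq> set l"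
    unfolding abc(7) by simp
  then show "\<exists>!b. b \<in> set ` set td6 \<and> T \<subseteq> b" by blast
qed

section \<open>The parity design on four groups\<close>

definition even_transversals :: "nat set \<Rightarrow> nat set set" where
  "even_transversals b = {h. h \<subseteq> dbl b \<and> card h = 4 \<and> transversal h \<and> even (\<Sum>h)}"

lemma transversal_insert:
  assumes "transversal T" "p div 2 \<notin> (\<lambda>p. p div 2) ` T"
  shows "transversal (insert p T)"
  using assms unfolding transversal_def by auto

text \<open>Recording the parity of each point turns the blocks into the binary words of length 4
  and even weight, where any three bits determine the fourth.\<close>

lemma transversal_design_even_transversals:
  assumes b: "card b = 4"
  shows "transversal_design b (even_transversals b)"
  unfolding transversal_design_def
proof (intro conjI ballI allI impI)
  fix h assume "h \<in> even_transversals b"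
  then show "h \<subseteq> dbl b" "card h = 4 \<or> card h = 6" "transversal h"
    by (simp_all add: even_transversals_def)
next
  fix T assume T: "T \<subseteq> dbl b \<and> card T = 3 \<and> transversal T"
  define t where "t = (\<lambda>p::nat. p div 2) ` T"
  have finb: "finite b" using b by (metis card.infinite zero_neq_numeral)
  have finT: "finite T" using T by (metis card.infinite zero_neq_numeral)
  have tb: "t \<subseteq> b" using T subset_dbl_iff unfolding t_def by blast
  have ct: "card t = 3" using T unfolding t_def transversal_def by (simp add: card_image)
  have "card (b - t) = 1" using card_Diff_subset[of t b] tb b ct finb finite_subset by fastforce
  then obtain y where y: "b - t = {y}" using card_1_singletonE by blast
  \<comment> \<open>\<open>y\<close> is the one group that \<open>T\<close> misses; \<open>q\<close>
    is the point of it that makes the sum of the block even.\<close>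
  define q where "q = 2 * y + (\<Sum>T) mod 2"
  have q: "q div 2 = y" by (simp add: q_def)
  have qT: "q \<notin> T" using q y unfolding t_def by blast
  have unique: "h = insert q T" if h: "h \<in> even_transversals b" "T \<subseteq> h" for h
  proof -
    have hb: "h \<subseteq> dbl b" "card h = 4" "transversal h" "even (\<Sum>h)"
      using h(1) by (simp_all add: even_transversals_def)
    have "card (h - T) = 1" using card_Diff_subset[of T h] h(2) hb(2) T finT by simp
    then obtain r where r: "h - T = {r}" using card_1_singletonE by blast
    then have hr: "h = insert r T" "r \<notin> T" using h(2) by blast+
    have "r div 2 \<notin> t"
    proof
      assume "r div 2 \<in> t"
      then obtain p where "p \<in> T" "r div 2 = p div 2" unfolding t_def by blast
      then have "r = p" using hb(3) hr unfolding transversal_def by (auto dest: inj_onD)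
      then show False using hr(2) \<open>p \<in> T\<close> by simp
    qed
    moreover have "r div 2 \<in> b" using hr(1) hb(1) by (simp add: dbl_def)
    ultimately have ry: "r div 2 = y" using y by blast
    have "even (r + \<Sum>T)" using hb(4) hr finT by simp
    then have "r mod 2 = (\<Sum>T) mod 2" by presburger
    then have "r = q" unfolding q_def using ry by (metis div_mult_mod_eq mult.commute)
    then show ?thesis using hr(1) by simp
  qed
  show "\<exists>!h. h \<in> even_transversals b \<and> T \<subseteq> h"
  proof (rule ex1I[of _ "insert q T"])
    have "transversal (insert q T)"
      by (rule transversal_insert) (use T y q in \<open>auto simp: t_def\<close>)
    moreover have "insert q T \<subseteq> dbl b" using T y q by (auto simp: dbl_def)
    moreover have "even (\<Sum>(insert q T))" using finT qT by (simp add: q_def)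
    moreover have "card (insert q T) = 4" using finT qT T by simp
    ultimately show "insert q T \<in> even_transversals b \<and> T \<subseteq> insert q T"
      by (simp add: even_transversals_def subset_insertI)
  next
    fix h assume "h \<in> even_transversals b \<and> T \<subseteq> h"
    then show "h = insert q T" using unique by simp
  qed
qed

text \<open>Size 4 needs the explicit design, because the blocks of the exclusive-or cube are later
  found in it; for size 6 any design will do.\<close>

lemma ex_transversal_design:
  assumes "card b = 4 \<or> card b = 6"
  shows "\<exists>H. transversal_design b H \<and> (card b = 4 \<longrightarrow> H = even_transversals b)"
proof (cases "card b = 4")
  case True
  then show ?thesis using transversal_design_even_transversals by blast
next
  case False
  then have "card {0..<6::nat} = card b" "finite b" using assms card.infinite by force+
  then obtain f where "bij_betw f {0..<6::nat} b" using finite_same_card_bij by blast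
  then have "transversal_design b ((`) (\<lambda>p. 2 * f (p div 2) + p mod 2) ` set ` set td6)"
    using transversal_design_image[OF transversal_design_td6] unfolding bij_betw_def by metis
  then show ?thesis using False by blast
qed

lemma is_S3_46_singleton: "card X = 4 \<or> card X = 6 \<Longrightarrow> is_S3_46 X {X}"
  unfolding is_S3_46_def by auto

text \<open>Sizes 3 and 5 are what remains of blocks after deleting a point. Their doubles have 6
  points, a single block, or 10 points, a copy of \<open>sqs10\<close>.\<close>

lemma ex_is_S3_46_dbl:
  assumes "card c = 3 \<or> card c = 5"
  shows "\<exists>G. is_S3_46 (dbl c) G"
proof (cases "card c = 5")
  case True
  then have "finite c" using card.infinite by force
  then have "card {0..<10::nat} = card (dbl c)" "finite (dbl c)"
    using True by (simp_all add: card_dbl finite_dbl)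
  then obtain f where "bij_betw f {0..<10::nat} (dbl c)" using finite_same_card_bij by blast
  then have "is_S3_46 (dbl c) ((`) f ` set ` set sqs10)"
    using is_S3_46_image[OF is_S3_46_sqs10] unfolding bij_betw_def by metis
  then show ?thesis by blast
next
  case False
  then have "card c = 3" "finite c" using assms card.infinite by force+
  then have "card (dbl c) = 6" by (simp add: card_dbl)
  then show ?thesis using is_S3_46_singleton by blast
qed

subsection \<open>Two recursive constructions\<close>

text \<open>Apply \<open>doubling\<close> with all pairs as \<open>CC\<close>; a doubled pair is a
  single block of size 4. The second conclusion provides the block \<open>{0, 1, 2, 3}\<close> in
  base cases, the third carries the cube along.\<close>

lemma is_S3_46_double:
  assumes S: "is_S3_46 {0..<u} B"
  shows "\<exists>D. is_S3_46 {0..<2 * u} D \<and> (\<forall>P. P \<subseteq> {0..<u} \<and> card P = 2 \<longrightarrow> dbl P \<in> D) \<and>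
    (\<forall>b\<in>B. card b = 4 \<longrightarrow> even_transversals b \<subseteq> D)"
proof -
  define CC where "CC = {P. P \<subseteq> {0..<u} \<and> card P = 2}"
  have "\<forall>b\<in>B. \<exists>H. transversal_design b H \<and> (card b = 4 \<longrightarrow> H = even_transversals b)"
    using ex_transversal_design is_S3_46_block[OF S] by simp
  from bchoice[OF this] obtain H
    where H: "\<forall>b\<in>B. transversal_design b (H b) \<and> (card b = 4 \<longrightarrow> H b = even_transversals b)" ..
  have S3: "is_S3_46 (dbl c) {dbl c}" if "c \<in> CC" for c
    by (rule is_S3_46_singleton)
      (use that card_dbl[of c] finite_subset[of c "{0..<u}"] in \<open>simp add: CC_def\<close>)
  have CCeq: "c \<in> CC \<and> P \<subseteq> c \<longleftrightarrow> c = P" if P: "P \<subseteq> {0..<u}" "card P = 2" for c P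
  proof
    assume c: "c \<in> CC \<and> P \<subseteq> c"
    then have "finite c" using finite_subset[of c "{0..<u}"] by (simp add: CC_def)
    then show "c = P" using c P card_subset_eq[of c P] by (simp add: CC_def)
  next
    assume "c = P"
    then show "c \<in> CC \<and> P \<subseteq> c" using P by (simp add: CC_def)
  qed
  have noCC: "\<not> T \<subseteq> c" if "card T = 3" "c \<in> CC" for T c
  proof
    assume "T \<subseteq> c"
    moreover have "finite c" using that(2) finite_subset[of c "{0..<u}"] by (simp add: CC_def)
    ultimately have "card T \<le> card c" using card_mono by blast
    then show False using that by (simp add: CC_def)
  qed
  have "is_S3_46 (dbl {0..<u}) ((\<Union>b\<in>B. H b) \<union> (\<Union>c\<in>CC. {dbl c}))"
  proof (rule doubling)
    fix b assume "b \<in> B"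
    then show "b \<subseteq> {0..<u} \<and> transversal_design b (H b)"
      using H is_S3_46_block[OF S, of b] by simp
  next
    fix c assume "c \<in> CC"
    then show "c \<subseteq> {0..<u} \<and> is_S3_46 (dbl c) {dbl c}" using S3[of c] by (simp add: CC_def)
  next
    show "B \<inter> CC = {}" using is_S3_46_block[OF S] by (force simp: CC_def)
  next
    fix P assume "P \<subseteq> {0..<u}" "card P = 2"
    then show "\<exists>!c. c \<in> CC \<and> P \<subseteq> c" using CCeq by simp
  next
    fix T assume T: "T \<subseteq> {0..<u}" "card T = 3"
    have "b \<in> B \<union> CC \<and> T \<subseteq> b \<longleftrightarrow> b \<in> B \<and> T \<subseteq> b" for b using noCC[OF T(2), of b] by auto
    then show "\<exists>!b. b \<in> B \<union> CC \<and> T \<subseteq> b" using is_S3_46_ex1[OF S T] by simp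
  qed
  then show ?thesis unfolding dbl_atLeastLessThan using H by (intro exI conjI) (auto simp: CC_def)
qed

text \<open>Blocks through the deleted point \<open>u\<close> lose it and form \<open>CC\<close>.
  They cover each pair once, since a pair together with \<open>u\<close> is a triple of the old
  design. Deleting the last point leaves an initial segment.\<close>

lemma is_S3_46_double_minus_point:
  assumes S: "is_S3_46 {0..<Suc u} B"
  shows "\<exists>D. is_S3_46 {0..<2 * u} D \<and>
    (\<forall>b\<in>B. card b = 4 \<and> u \<notin> b \<longrightarrow> even_transversals b \<subseteq> D)"
proof -
  define BB where "BB = {b \<in> B. u \<notin> b}"
  define CC where "CC = (\<lambda>b. b - {u}) ` {b \<in> B. u \<in> b}"
  have blk: "b \<subseteq> {0..<Suc u}" "card b = 4 \<or> card b = 6" if "b \<in> B" for b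
    using is_S3_46_block[OF S that] by simp_all
  have "\<forall>b\<in>B. \<exists>H. transversal_design b H \<and> (card b = 4 \<longrightarrow> H = even_transversals b)"
    using ex_transversal_design is_S3_46_block[OF S] by simp
  from bchoice[OF this] obtain H
    where H: "\<forall>b\<in>B. transversal_design b (H b) \<and> (card b = 4 \<longrightarrow> H b = even_transversals b)" ..
  have CC: "c \<subseteq> {0..<u} \<and> (card c = 3 \<or> card c = 5) \<and> insert u c \<in> B" if c: "c \<in> CC" for c
  proof -
    obtain b where b: "b \<in> B" "u \<in> b" "c = b - {u}" using c unfolding CC_def by blast
    have "card c = card b - 1" using b by simp
    moreover have "c \<subseteq> {0..<u}" using b blk(1)[OF b(1)] by auto
    moreover have "insert u c = b" using b by blast
    ultimately show ?thesis using b blk(2)[OF b(1)] by auto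
  qed
  have CCI: "c \<in> CC" if "insert u c \<in> B" "c \<subseteq> {0..<u}" for c
  proof -
    have "c = insert u c - {u}" using that(2) by auto
    then show ?thesis unfolding CC_def using that(1) by blast
  qed
  have "\<forall>c\<in>CC. \<exists>G. is_S3_46 (dbl c) G" using ex_is_S3_46_dbl CC by meson
  from bchoice[OF this] obtain G where G: "\<forall>c\<in>CC. is_S3_46 (dbl c) (G c)" ..
  have "is_S3_46 (dbl {0..<u}) ((\<Union>b\<in>BB. H b) \<union> (\<Union>c\<in>CC. G c))"
  proof (rule doubling)
    fix b assume b: "b \<in> BB"
    then have "b \<subseteq> {0..<u}" using blk(1)[of b] by (force simp: BB_def less_Suc_eq)
    then show "b \<subseteq> {0..<u} \<and> transversal_design b (H b)" using H b by (simp add: BB_def)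
  next
    fix c assume "c \<in> CC"
    then show "c \<subseteq> {0..<u} \<and> is_S3_46 (dbl c) (G c)" using G CC by simp
  next
    \<comment> \<open>Sizes in \<open>BB\<close> are even, those in \<open>CC\<close> odd.\<close>
    show "BB \<inter> CC = {}" using blk(2) CC unfolding BB_def by fastforce
  next
    fix P assume P: "P \<subseteq> {0..<u}" "card P = 2"
    have "u \<notin> P" using P(1) by auto
    then have "card (insert u P) = 3" using P finite_subset[of P "{0..<u}"] by auto
    moreover have "insert u P \<subseteq> {0..<Suc u}" using P(1) by auto
    ultimately have "\<exists>!b. b \<in> B \<and> insert u P \<subseteq> b" by (intro is_S3_46_ex1[OF S])
    then obtain b where b: "b \<in> B \<and> insert u P \<subseteq> b"
      and uniq: "\<forall>b'. b' \<in> B \<and> insert u P \<subseteq> b' \<longrightarrow> b' = b" by (rule ex1E)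
    show "\<exists>!c. c \<in> CC \<and> P \<subseteq> c"
    proof (rule ex1I[of _ "b - {u}"])
      show "b - {u} \<in> CC \<and> P \<subseteq> b - {u}" using b P unfolding CC_def by auto
      fix c assume c: "c \<in> CC \<and> P \<subseteq> c"
      then have "insert u c = b" using CC[of c] uniq by (metis insert_mono)
      moreover have "u \<notin> c" using CC[of c] c by auto
      ultimately show "c = b - {u}" by blast
    qed
  next
    fix T assume T: "T \<subseteq> {0..<u}" "card T = 3"
    have uT: "u \<notin> T" using T(1) by auto
    have "T \<subseteq> {0..<Suc u}" using T(1) by auto
    then have "\<exists>!b. b \<in> B \<and> T \<subseteq> b" using is_S3_46_ex1[OF S] T(2) by simp
    then obtain b where b: "b \<in> B \<and> T \<subseteq> b"
      and uniq: "\<forall>b'. b' \<in> B \<and> T \<subseteq> b' \<longrightarrow> b' = b" by (rule ex1E)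
    show "\<exists>!b. b \<in> BB \<union> CC \<and> T \<subseteq> b"
    \<comment> \<open>If \<open>b\<close> avoids \<open>u\<close> this is \<open>b\<close> itself,
      so one witness serves both cases.\<close>
    proof (rule ex1I[of _ "b - {u}"])
      show "b - {u} \<in> BB \<union> CC \<and> T \<subseteq> b - {u}"
        using b uT unfolding BB_def CC_def by (cases "u \<in> b") auto
      fix c assume c: "c \<in> BB \<union> CC \<and> T \<subseteq> c"
      show "c = b - {u}"
      proof (cases "c \<in> BB")
        case True
        then show ?thesis using c uniq unfolding BB_def by auto
      next
        case False
        then have cC: "c \<in> CC" using c by simp
        then have "insert u c = b" using CC[of c] uniq c by (metis subset_insertI2)
        moreover have "u \<notin> c" using CC[OF cC] by auto
        ultimately show ?thesis by blast
      qed
    qed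
  qed
  then show ?thesis unfolding dbl_atLeastLessThan using H by (intro exI conjI) (auto simp: BB_def)
qed

subsection \<open>Designs containing the blocks of the exclusive-or cube\<close>

text \<open>The first \<open>4 * m\<close> points form four segments of length \<open>m\<close>; for
  arguments below \<open>m\<close> the block takes one point from each.\<close>

definition quad :: "nat \<Rightarrow> nat \<Rightarrow> nat \<Rightarrow> nat \<Rightarrow> nat \<Rightarrow> nat set" where
  "quad m x y z w = {x, m + y, 2 * m + z, 3 * m + w}"

text \<open>The sum in an elementary abelian 2-group. It commutes with halving, and its arguments
  and value have even total: exactly what doubling with the parity design needs.\<close>

definition xor3 :: "nat \<Rightarrow> nat \<Rightarrow> nat \<Rightarrow> nat" where
  "xor3 x y z = xor x (xor y z)"

lemma xor_less_pow2: "x < 2 ^ e \<Longrightarrow> y < 2 ^ e \<Longrightarrow> xor x y < (2::nat) ^ e"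
  by (metis take_bit_nat_eq_self_iff take_bit_xor)

lemma xor3_less_pow2: "x < 2 ^ e \<Longrightarrow> y < 2 ^ e \<Longrightarrow> z < 2 ^ e \<Longrightarrow> xor3 x y z < 2 ^ e"
  by (simp add: xor3_def xor_less_pow2)

lemma xor3_half: "xor3 x y z div 2 = xor3 (x div 2) (y div 2) (z div 2)"
proof -
  have "drop_bit 1 (xor3 x y z) = xor3 (drop_bit 1 x) (drop_bit 1 y) (drop_bit 1 z)"
    by (simp only: xor3_def drop_bit_xor)
  then show ?thesis by (simp add: drop_bit_eq_div)
qed

lemma even_xor3: "even (x + y + z + xor3 x y z)"
  by (auto simp: xor3_def even_xor_iff)

lemma card_quad:
  assumes "x < m" "y < m" "z < m" "w < m"
  shows "card (quad m x y z w) = 4"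
  using assms by (simp add: quad_def)

text \<open>The new segments start at even points, so halving acts on each coordinate separately.
  Their offsets add up to \<open>12 * m\<close>, so only the parity of \<open>x + y + z + w\<close>
  counts.\<close>

lemma quad_double_in_even_transversals:
  assumes "x < 2 * m" "y < 2 * m" "z < 2 * m" "w < 2 * m" "even (x + y + z + w)"
  shows "quad (2 * m) x y z w \<in> even_transversals (quad m (x div 2) (y div 2) (z div 2) (w div 2))"
proof -
  have half: "(2 * m + y) div 2 = m + y div 2" "(4 * m + z) div 2 = 2 * m + z div 2"
    "(6 * m + w) div 2 = 3 * m + w div 2" by linarith+
  have lt: "x div 2 < m" "y div 2 < m" "z div 2 < m" "w div 2 < m" using assms by linarith+
  have "transversal (quad (2 * m) x y z w)"
    using lt unfolding transversal_def quad_def by (auto simp: half inj_on_insert)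
  moreover have "\<Sum>(quad (2 * m) x y z w) = 12 * m + (x + y + z + w)"
    using assms(1-4) by (simp add: quad_def)
  ultimately show ?thesis
    using card_quad[OF assms(1-4)] assms(5) unfolding even_transversals_def
    by (simp add: subset_dbl_iff) (simp add: quad_def half)
qed

text \<open>The lower bound on \<open>v\<close> keeps the last point, which may be deleted, outside
  the cube; the upper bound makes \<open>m\<close> linear in \<open>v\<close>.\<close>

definition xor_design :: "nat \<Rightarrow> nat \<Rightarrow> nat set set \<Rightarrow> bool" where
  "xor_design v m B \<longleftrightarrow> is_S3_46 {0..<v} B \<and> 4 * m < v \<and> v \<le> 12 * m \<and>
     (\<forall>x<m. \<forall>y<m. \<forall>z<m. quad m x y z (xor3 x y z) \<in> B)"

text \<open>Halving the coordinates leads to a cell of the smaller cube by \<open>xor3_half\<close>,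
  and by \<open>even_xor3\<close> the new block is an even transversal over the block of that
  cell.\<close>

lemma quad_xor3_double:
  assumes "\<And>x y z. x < 2 ^ e \<Longrightarrow> y < 2 ^ e \<Longrightarrow> z < 2 ^ e \<Longrightarrow>
      even_transversals (quad (2 ^ e) x y z (xor3 x y z)) \<subseteq> D"
    and "x < 2 ^ Suc e" "y < 2 ^ Suc e" "z < 2 ^ Suc e"
  shows "quad (2 ^ Suc e) x y z (xor3 x y z) \<in> D"
proof -
  have "even_transversals (quad (2 ^ e) (x div 2) (y div 2) (z div 2) (xor3 x y z div 2)) \<subseteq> D"
    unfolding xor3_half by (rule assms(1)) (use assms(2-4) in simp_all)
  moreover have "xor3 x y z < 2 ^ Suc e" using assms(2-4) by (rule xor3_less_pow2)
  then have "quad (2 * 2 ^ e) x y z (xor3 x y z)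
      \<in> even_transversals (quad (2 ^ e) (x div 2) (y div 2) (z div 2) (xor3 x y z div 2))"
    using assms(2-4) by (intro quad_double_in_even_transversals even_xor3) simp_all
  ultimately show ?thesis by auto
qed

lemma xor_design_double:
  assumes "xor_design u (2 ^ e) B"
  shows "\<exists>D. xor_design (2 * u) (2 ^ Suc e) D"
proof -
  have S: "is_S3_46 {0..<u} B" using assms by (simp add: xor_design_def)
  obtain D where D: "is_S3_46 {0..<2 * u} D"
    "\<forall>b\<in>B. card b = 4 \<longrightarrow> even_transversals b \<subseteq> D" using is_S3_46_double[OF S] by auto
  have "quad (2 ^ Suc e) x y z (xor3 x y z) \<in> D"
    if "x < 2 ^ Suc e" "y < 2 ^ Suc e" "z < 2 ^ Suc e" for x y z
  proof (rule quad_xor3_double[OF _ that])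
    fix x y z :: nat assume xyz: "x < 2 ^ e" "y < 2 ^ e" "z < 2 ^ e"
    have "quad (2 ^ e) x y z (xor3 x y z) \<in> B" using assms xyz by (simp add: xor_design_def)
    then show "even_transversals (quad (2 ^ e) x y z (xor3 x y z)) \<subseteq> D"
      using D(2) card_quad xor3_less_pow2 xyz by simp
  qed
  then show ?thesis using D(1) assms unfolding xor_design_def by (intro exI[of _ D]) simp
qed

lemma xor_design_double_minus_point:
  assumes "xor_design (Suc u) (2 ^ e) B" "odd u"
  shows "\<exists>D. xor_design (2 * u) (2 ^ Suc e) D"
proof -
  have S: "is_S3_46 {0..<Suc u} B" using assms by (simp add: xor_design_def)
  obtain D where D: "is_S3_46 {0..<2 * u} D"
    "\<forall>b\<in>B. card b = 4 \<and> u \<notin> b \<longrightarrow> even_transversals b \<subseteq> D"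
    using is_S3_46_double_minus_point[OF S] by auto
  have um: "4 * 2 ^ e \<le> u" using assms(1) by (simp add: xor_design_def)
  \<comment> \<open>Equality is impossible because \<open>u\<close> is odd; this keeps the lower
    bound strict after losing a point.\<close>
  then have um': "4 * 2 ^ e < u" using assms(2) by (metis dvd_triv_left even_mult_iff even_numeral le_neq_implies_less)
  have "quad (2 ^ Suc e) x y z (xor3 x y z) \<in> D"
    if "x < 2 ^ Suc e" "y < 2 ^ Suc e" "z < 2 ^ Suc e" for x y z
  proof (rule quad_xor3_double[OF _ that])
    fix x y z :: nat assume xyz: "x < 2 ^ e" "y < 2 ^ e" "z < 2 ^ e"
    have "quad (2 ^ e) x y z (xor3 x y z) \<in> B" using assms xyz by (simp add: xor_design_def)
    \<comment> \<open>Cube blocks lie within the first \<open>4 * 2 ^ e\<close> points, so none is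
      lost.\<close>
    moreover have "u \<notin> quad (2 ^ e) x y z (xor3 x y z)"
      using xyz xor3_less_pow2[OF xyz] um by (auto simp: quad_def)
    ultimately show "even_transversals (quad (2 ^ e) x y z (xor3 x y z)) \<subseteq> D"
      using D(2) card_quad xor3_less_pow2 xyz by simp
  qed
  then show ?thesis using D(1) assms um' unfolding xor_design_def by (intro exI[of _ D]) simp
qed

lemma xor_design_base:
  assumes "is_S3_46 {0..<v} B" "{0, 1, 2, 3} \<in> B" "4 < v" "v \<le> 12"
  shows "xor_design v (2 ^ 0) B"
  using assms by (simp add: xor_design_def quad_def xor3_def numeral_eq_Suc)

text \<open>If 4 divides \<open>v\<close>, double a design on \<open>v div 2\<close> points;
  otherwise \<open>v div 2\<close> is odd, so use one more point and delete it. Orders 8, 10 and 12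
  start the induction with \<open>m = 1\<close>, when the cube is the block
  \<open>{0, 1, 2, 3}\<close>.\<close>

lemma ex_xor_design:
  assumes "even v" "8 \<le> v"
  shows "\<exists>e B. xor_design v (2 ^ e) B"
  using assms
proof (induction v rule: less_induct)
  case (less v)
  have dbl01: "dbl {0, 1} = {0, 1, 2, 3}" by (auto simp: dbl_eq_image)
  have double: "\<exists>D. is_S3_46 {0..<2 * u} D \<and> {0, 1, 2, 3} \<in> D" if "u = 4 \<or> u = 6" for u :: nat
  proof -
    have "is_S3_46 {0..<u} {{0..<u}}" using that by (intro is_S3_46_singleton) auto
    from is_S3_46_double[OF this] obtain D where D: "is_S3_46 {0..<2 * u} D"
      and P: "\<forall>P. P \<subseteq> {0..<u} \<and> card P = 2 \<longrightarrow> dbl P \<in> D" by metis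
    have "dbl {0, 1} \<in> D" by (rule P[rule_format]) (use that in auto)
    then show ?thesis using D dbl01 by auto
  qed
  have base: "\<exists>e B. xor_design v (2 ^ e) B" if "is_S3_46 {0..<v} B" "{0, 1, 2, 3} \<in> B" "v \<le> 12" for B
    using xor_design_base[OF that(1,2) _ that(3)] less.prems by (intro exI[of _ 0] exI[of _ B]) simp
  have "v = 2 * 4 \<or> v = 10 \<or> v = 2 * 6 \<or> 14 \<le> v \<and> (v mod 4 = 0 \<or> v mod 4 = 2)"
    using less.prems by presburger
  then consider "v = 2 * 4" | "v = 10" | "v = 2 * 6" | "14 \<le> v" "v mod 4 = 0" | "14 \<le> v" "v mod 4 = 2"
    by (elim disjE conjE) simp_all
  then show ?case
  proof cases
    case 1
    then show ?thesis using double[of 4] base by auto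
  next
    case 2
    have "set [0, 1, 2, 3] \<in> set ` set sqs10" by (rule imageI) (simp add: sqs10_def)
    then show ?thesis using base[of "set ` set sqs10"] is_S3_46_sqs10 2 by simp
  next
    case 3
    then show ?thesis using double[of 6] base by auto
  next
    case 4
    obtain u where u: "v = 2 * u" "even u" using 4(2) by (intro that[of "v div 2"]) presburger+
    then have "8 \<le> u" using 4(1) by presburger
    then obtain e B where "xor_design u (2 ^ e) B" using less.IH[of u] u by auto
    then show ?thesis using xor_design_double u(1) by blast
  next
    case 5
    obtain u where u: "v = 2 * u" "odd u" using 5(2) by (intro that[of "v div 2"]) presburger+
    then obtain e B where "xor_design (Suc u) (2 ^ e) B" using less.IH[of "Suc u"] 5(1) by auto
    then show ?thesis using xor_design_double_minus_point u by blast
  qed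
qed

subsection \<open>Switching Latin cubes\<close>

definition latin_cube :: "nat \<Rightarrow> (nat \<Rightarrow> nat \<Rightarrow> nat \<Rightarrow> nat) \<Rightarrow> bool" where
  "latin_cube m f \<longleftrightarrow> (\<forall>x<m. \<forall>y<m. \<forall>z<m. f x y z < m) \<and>
     (\<forall>y<m. \<forall>z<m. inj_on (\<lambda>x. f x y z) {..<m}) \<and>
     (\<forall>x<m. \<forall>z<m. inj_on (\<lambda>y. f x y z) {..<m}) \<and>
     (\<forall>x<m. \<forall>y<m. inj_on (\<lambda>z. f x y z) {..<m})"

definition quads :: "nat \<Rightarrow> (nat \<Rightarrow> nat \<Rightarrow> nat \<Rightarrow> nat) \<Rightarrow> nat set set" where
  "quads m f = {quad m x y z (f x y z) | x y z. x < m \<and> y < m \<and> z < m}"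

lemma quadsI: "x < m \<Longrightarrow> y < m \<Longrightarrow> z < m \<Longrightarrow> quad m x y z (f x y z) \<in> quads m f"
  unfolding quads_def by blast

lemma latin_cube_less: "latin_cube m f \<Longrightarrow> x < m \<Longrightarrow> y < m \<Longrightarrow> z < m \<Longrightarrow> f x y z < m"
  by (simp add: latin_cube_def)

lemma latin_cube_cancel:
  assumes "latin_cube m f" "x < m" "y < m" "z < m" "w < m"
  shows "f w y z = f x y z \<Longrightarrow> w = x" "f x w z = f x y z \<Longrightarrow> w = y" "f x y w = f x y z \<Longrightarrow> w = z"
  using assms unfolding latin_cube_def inj_on_def by (metis lessThan_iff)+

lemma inj_on_lessThan_solve:
  fixes g :: "nat \<Rightarrow> nat"
  assumes "inj_on g {..<m}" "\<And>x. x < m \<Longrightarrow> g x < m" "w < m"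
  obtains x where "x < m" "g x = w"
proof -
  have "g ` {..<m} = {..<m}" by (rule endo_inj_surj) (use assms in auto)
  then show ?thesis using assms(3) that by (metis imageE lessThan_iff)
qed

section \<open>Triples covered by the blocks of a Latin cube\<close>

lemma quad_div:
  assumes "p \<in> quad m x y z w" "x < m" "y < m" "z < m" "w < m"
  shows "p < 4 * m" "p = (p div m) * m + [x, y, z, w] ! (p div m)"
proof -
  have "(m + y) div m = 1" "(2 * m + z) div m = 2" "(3 * m + w) div m = 3" "x div m = 0"
    using assms(2-5) by (simp_all add: div_nat_eqI)
  then show "p < 4 * m" "p = (p div m) * m + [x, y, z, w] ! (p div m)"
    using assms by (auto simp: quad_def)
qed

lemma quads_cover_imp:
  assumes f: "latin_cube m f" and b: "b \<in> quads m f" "T \<subseteq> b"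
  shows "T \<subseteq> {0..<4 * m}" "inj_on (\<lambda>p. p div m) T"
proof -
  obtain x y z where xyz: "x < m" "y < m" "z < m" "b = quad m x y z (f x y z)"
    using b(1) by (auto simp: quads_def)
  note q = quad_div[OF _ xyz(1-3) latin_cube_less[OF f xyz(1-3)]]
  show "T \<subseteq> {0..<4 * m}" using q(1) b(2) xyz(4) by auto
  show "inj_on (\<lambda>p. p div m) T"
  proof (rule inj_onI)
    fix p r assume "p \<in> T" "r \<in> T" "p div m = r div m"
    then show "p = r" using q(2)[of p] q(2)[of r] b(2) xyz(4) by (metis subsetD)
  qed
qed

text \<open>With \<open>quads_cover_imp\<close>, the covered triples are those in three different
  segments, whatever \<open>f\<close> is. If \<open>T\<close> misses the last segment, evaluate
  \<open>f\<close>; otherwise the Latin property solves for the missing argument.\<close>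

lemma quads_ex1:
  assumes f: "latin_cube m f" and T: "T \<subseteq> {0..<4 * m}" "card T = 3" "inj_on (\<lambda>p. p div m) T"
  shows "\<exists>!b. b \<in> quads m f \<and> T \<subseteq> b"
proof -
  define t where "t = (\<lambda>p. p div m) ` T"
  have less4: "p div m < 4" if "p \<in> T" for p
  proof -
    have "p < 4 * m" using that T(1) by auto
    then show ?thesis by (rule less_mult_imp_div_less)
  qed
  have "card t = 3" using T unfolding t_def by (simp add: card_image)
  moreover have "card {0, 1, 2, 3::nat} = 4" by simp
  ultimately have "\<not> {0, 1, 2, 3} \<subseteq> t"
    using card_mono[of t "{0,1,2,3}"] card.infinite[of t] by force
  then have missing: "0 \<notin> t \<or> 1 \<notin> t \<or> 2 \<notin> t \<or> 3 \<notin> t" by blast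
  have t3: "\<And>i. i < 4 \<Longrightarrow> i \<noteq> j \<Longrightarrow> i \<in> t" if "j \<notin> t" "j < 4" for j
  proof -
    have "t \<subseteq> {0..<4} - {j}" using less4 that unfolding t_def by auto
    moreover have "card ({0..<4} - {j}) = 3" using that by simp
    ultimately have "t = {0..<4} - {j}" using \<open>card t = 3\<close> by (intro card_subset_eq) auto
    then show "\<And>i. i < 4 \<Longrightarrow> i \<noteq> j \<Longrightarrow> i \<in> t" by simp
  qed
  have m: "0 < m" using T(1,2) by (cases m) auto
  \<comment> \<open>The coordinate of the point of \<open>T\<close> in segment \<open>i\<close>; for
    \<open>i\<close> outside \<open>t\<close> it is arbitrary, but still below
    \<open>m\<close>.\<close>
  define c where "c i = inv_into T (\<lambda>p. p div m) i mod m" for i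
  have cm: "c i < m" for i using m by (simp add: c_def)
  have pc: "p = (p div m) * m + c (p div m)" if "p \<in> T" for p
    using inv_into_f_f[OF T(3) that] by (simp add: c_def)
  have sub: "T \<subseteq> quad m x y z w"
    if "0 \<in> t \<longrightarrow> x = c 0" "1 \<in> t \<longrightarrow> y = c 1" "2 \<in> t \<longrightarrow> z = c 2" "3 \<in> t \<longrightarrow> w = c 3" for x y z w
  proof
    fix p assume p: "p \<in> T"
    then have "p div m \<in> t" by (simp add: t_def)
    moreover have "p div m = 0 \<or> p div m = 1 \<or> p div m = 2 \<or> p div m = 3" using less4[OF p] by linarith
    ultimately show "p \<in> quad m x y z w"
      using pc[OF p] that unfolding quad_def by (elim disjE) simp_all
  qed
  have subD: "(0 \<in> t \<longrightarrow> x = c 0) \<and> (1 \<in> t \<longrightarrow> y = c 1) \<and> (2 \<in> t \<longrightarrow> z = c 2) \<and> (3 \<in> t \<longrightarrow> w = c 3)"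
    if "T \<subseteq> quad m x y z w" "x < m" "y < m" "z < m" "w < m" for x y z w
  proof -
    have "[x, y, z, w] ! i = c i" if "i \<in> t" for i
    proof -
      obtain p where p: "p \<in> T" "i = p div m" using \<open>i \<in> t\<close> unfolding t_def by blast
      have "p \<in> quad m x y z w" using p(1) \<open>T \<subseteq> quad m x y z w\<close> by blast
      from quad_div(2)[OF this \<open>x < m\<close> \<open>y < m\<close> \<open>z < m\<close> \<open>w < m\<close>] pc[OF p(1)]
      show ?thesis unfolding p(2) by linarith
    qed
    from this[of 0] this[of 1] this[of 2] this[of 3] show ?thesis by simp
  qed
  have "\<exists>x<m. \<exists>y<m. \<exists>z<m. (0 \<in> t \<longrightarrow> x = c 0) \<and> (1 \<in> t \<longrightarrow> y = c 1) \<and> (2 \<in> t \<longrightarrow> z = c 2) \<and>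
      (3 \<in> t \<longrightarrow> f x y z = c 3)"
    using missing
  proof (elim disjE)
    assume "0 \<notin> t"
    moreover obtain x where "x < m" "f x (c 1) (c 2) = c 3"
      by (rule inj_on_lessThan_solve[of "\<lambda>x. f x (c 1) (c 2)" m "c 3"])
        (use f cm in \<open>simp_all add: latin_cube_def\<close>)
    ultimately show ?thesis using cm by blast
  next
    assume "1 \<notin> t"
    moreover obtain y where "y < m" "f (c 0) y (c 2) = c 3"
      by (rule inj_on_lessThan_solve[of "\<lambda>y. f (c 0) y (c 2)" m "c 3"])
        (use f cm in \<open>simp_all add: latin_cube_def\<close>)
    ultimately show ?thesis using cm by blast
  next
    assume "2 \<notin> t"
    moreover obtain z where "z < m" "f (c 0) (c 1) z = c 3"
      by (rule inj_on_lessThan_solve[of "\<lambda>z. f (c 0) (c 1) z" m "c 3"])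
        (use f cm in \<open>simp_all add: latin_cube_def\<close>)
    ultimately show ?thesis using cm by blast
  next
    assume "3 \<notin> t"
    then show ?thesis using cm by blast
  qed
  then obtain x y z where xyz: "x < m" "y < m" "z < m" "0 \<in> t \<longrightarrow> x = c 0" "1 \<in> t \<longrightarrow> y = c 1"
    "2 \<in> t \<longrightarrow> z = c 2" "3 \<in> t \<longrightarrow> f x y z = c 3" by blast
  show ?thesis
  proof (rule ex1I[of _ "quad m x y z (f x y z)"])
    show "quad m x y z (f x y z) \<in> quads m f \<and> T \<subseteq> quad m x y z (f x y z)"
      using sub[OF xyz(4-7)] quadsI[OF xyz(1-3)] by simp
    fix b assume b: "b \<in> quads m f \<and> T \<subseteq> b"
    then obtain x' y' z' where xyz': "x' < m" "y' < m" "z' < m" "b = quad m x' y' z' (f x' y' z')"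
      by (auto simp: quads_def)
    note eq = subD[OF _ xyz'(1-3) latin_cube_less[OF f xyz'(1-3)]]
    have eqs: "0 \<in> t \<longrightarrow> x' = c 0" "1 \<in> t \<longrightarrow> y' = c 1" "2 \<in> t \<longrightarrow> z' = c 2"
      "3 \<in> t \<longrightarrow> f x' y' z' = c 3" using eq b xyz'(4) by auto
    have "x' = x \<and> y' = y \<and> z' = z"
      using missing
    proof (elim disjE)
      assume "0 \<notin> t"
      with t3[of 0] have "y' = y" "z' = z" "f x' y z = f x y z" using eqs xyz(4-7) by auto
      then show ?thesis using latin_cube_cancel(1)[OF f xyz(1-3) xyz'(1)] by simp
    next
      assume "1 \<notin> t"
      with t3[of 1] have "x' = x" "z' = z" "f x y' z = f x y z" using eqs xyz(4-7) by auto
      then show ?thesis using latin_cube_cancel(2)[OF f xyz(1-3) xyz'(2)] by simp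
    next
      assume "2 \<notin> t"
      with t3[of 2] have "x' = x" "y' = y" "f x y z' = f x y z" using eqs xyz(4-7) by auto
      then show ?thesis using latin_cube_cancel(3)[OF f xyz(1-3) xyz'(3)] by simp
    next
      assume "3 \<notin> t"
      with t3[of 3] show ?thesis using eqs xyz(4-7) by auto
    qed
    then show "b = quad m x y z (f x y z)" using xyz'(4) by simp
  qed
qed

text \<open>Both cubes cover the same triples, so the blocks kept from \<open>B\<close> cover
  precisely the others.\<close>

lemma is_S3_46_switch:
  assumes S: "is_S3_46 {0..<v} B" and v: "4 * m \<le> v" and f: "latin_cube m f" and g: "latin_cube m g"
    and fB: "quads m f \<subseteq> B"
  shows "is_S3_46 {0..<v} (B - quads m f \<union> quads m g)" (is "is_S3_46 _ ?D")
  unfolding is_S3_46_def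
proof (intro conjI ballI allI impI)
  fix b assume "b \<in> ?D"
  then consider "b \<in> B" | "b \<in> quads m g" by blast
  then have "b \<subseteq> {0..<v} \<and> (card b = 4 \<or> card b = 6)"
  proof cases
    case 1
    then show ?thesis using is_S3_46_block[OF S] by simp
  next
    case 2
    then have "b \<subseteq> {0..<4 * m}" using quads_cover_imp(1)[OF g _ order_refl] by simp
    moreover have "card b = 4" using 2 card_quad latin_cube_less[OF g] by (auto simp: quads_def)
    ultimately show ?thesis using v by auto
  qed
  then show "b \<subseteq> {0..<v}" "card b = 4 \<or> card b = 6" by simp_all
next
  fix T assume T: "T \<subseteq> {0..<v} \<and> card T = 3"
  then have exB: "\<exists>!b. b \<in> B \<and> T \<subseteq> b" using is_S3_46_ex1[OF S] by simp
  show "\<exists>!b. b \<in> ?D \<and> T \<subseteq> b"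
  proof (cases "T \<subseteq> {0..<4 * m} \<and> inj_on (\<lambda>p. p div m) T")
    case True
    then have ex: "\<exists>!b. b \<in> quads m f \<and> T \<subseteq> b" "\<exists>!b. b \<in> quads m g \<and> T \<subseteq> b"
      using quads_ex1[OF f, of T] quads_ex1[OF g, of T] T by simp_all
    then obtain b where b: "b \<in> quads m f" "T \<subseteq> b" by blast
    have "b' \<in> quads m f" if "b' \<in> B" "T \<subseteq> b'" for b'
    proof -
      have "b' = b" using exB that b fB by (metis subsetD)
      then show ?thesis using b by simp
    qed
    then have "b \<in> ?D \<and> T \<subseteq> b \<longleftrightarrow> b \<in> quads m g \<and> T \<subseteq> b" for b by auto
    then show ?thesis using ex(2) by simp
  next
    case False
    then have "\<not> T \<subseteq> b" if "b \<in> quads m f \<or> b \<in> quads m g" for b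
      using that quads_cover_imp[OF f, of b T] quads_cover_imp[OF g, of b T] by auto
    then have "b \<in> ?D \<and> T \<subseteq> b \<longleftrightarrow> b \<in> B \<and> T \<subseteq> b" for b by auto
    then show ?thesis using exB by simp
  qed
qed

text \<open>Points in the first three segments lie in a unique block of \<open>D\<close>, whose only
  point from \<open>3 * m\<close> on reveals the value of the cube.\<close>

lemma quads_determined:
  assumes S: "is_S3_46 {0..<v} D" and v: "4 * m \<le> v" and D: "quads m f \<subseteq> D" "quads m g \<subseteq> D"
    and f: "latin_cube m f" and g: "latin_cube m g"
    and xyz: "x < m" "y < m" "z < m"
  shows "f x y z = g x y z"
proof -
  let ?T = "{x, m + y, 2 * m + z}"
  have T: "?T \<subseteq> {0..<v}" "card ?T = 3" using xyz v by auto
  have "quad m x y z (f x y z) \<in> D" "quad m x y z (g x y z) \<in> D"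
    using D quadsI[OF xyz] by blast+
  moreover have "?T \<subseteq> quad m x y z (f x y z)" "?T \<subseteq> quad m x y z (g x y z)"
    by (auto simp: quad_def)
  ultimately have "quad m x y z (f x y z) = quad m x y z (g x y z)"
    using is_S3_46_ex1[OF S T] by metis
  moreover have "3 * m + f x y z \<in> quad m x y z (f x y z)" by (simp add: quad_def)
  ultimately have "3 * m + f x y z \<in> quad m x y z (g x y z)" by simp
  then show ?thesis using xyz latin_cube_less[OF f xyz] by (auto simp: quad_def)
qed

subsection \<open>Many Latin cubes near the exclusive-or cube\<close>

text \<open>A coset of the cube of the subgroup \<open>{0, d}\<close>. For nonzero \<open>d\<close>,
  \<open>xor3\<close> has just two values on it, differing by \<open>d\<close>; adding
  \<open>d\<close> swaps them.\<close>

fun shift_cube :: "nat \<Rightarrow> nat \<times> nat \<times> nat \<Rightarrow> (nat \<times> nat \<times> nat) set" where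
  "shift_cube d (x, y, z) = {x, xor x d} \<times> {y, xor y d} \<times> {z, xor z d}"

definition grid :: "nat \<Rightarrow> (nat \<times> nat \<times> nat) set" where
  "grid m = {..<m} \<times> {..<m} \<times> {..<m}"

definition supp :: "('a \<Rightarrow> nat) \<Rightarrow> 'a set" where
  "supp d = {p. d p \<noteq> 0}"

text \<open>
  Along every axis the map \<open>x \<mapsto> xor x (d (x, y, z))\<close> is then an involution, so that adding \<open>d\<close>
  to the exclusive-or cube keeps it Latin.
\<close>

definition perturbations :: "nat \<Rightarrow> nat \<Rightarrow> (nat \<times> nat \<times> nat \<Rightarrow> nat) set" where
  "perturbations m j = {d. supp d \<subseteq> grid m \<and> (\<forall>p. d p < m) \<and>
     (\<forall>p\<in>supp d. \<forall>q\<in>shift_cube (d p) p. d q = d p) \<and> card (supp d) = 8 * j}"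

lemma xor_cancel_right: "xor (xor x d) d = (x::nat)"
  by (simp add: xor.assoc)

lemma xor_eq_self_iff: "xor x d = (x::nat) \<longleftrightarrow> d = 0"
proof
  assume "xor x d = x"
  moreover have "xor x (xor x d) = d" by (simp flip: xor.assoc)
  ultimately show "d = 0" by simp
qed simp

lemma shift_cube_self: "p \<in> shift_cube d p"
  by (cases p) simp

lemma shift_cube_eq:
  assumes "q \<in> shift_cube d p"
  shows "shift_cube d q = shift_cube d p"
proof -
  obtain x y z where p: "p = (x, y, z)" by (cases p)
  obtain x' y' z' where q: "q = (x', y', z')" by (cases q)
  have eq: "{a', xor a' d} = {a, xor a d}" if "a' \<in> {a, xor a d}" for a a'
    using that by (auto simp: xor_cancel_right)
  have "x' \<in> {x, xor x d}" "y' \<in> {y, xor y d}" "z' \<in> {z, xor z d}"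
    using assms unfolding p q shift_cube.simps by blast+
  from this[THEN eq] show ?thesis unfolding p q shift_cube.simps by presburger
qed

lemma shift_cube_sym: "q \<in> shift_cube d p \<Longrightarrow> p \<in> shift_cube d q"
  using shift_cube_eq shift_cube_self by blast

lemma finite_shift_cube: "finite (shift_cube d p)"
  by (cases p) simp

lemma card_shift_cube: assumes "d \<noteq> 0" shows "card (shift_cube d p) = 8"
proof -
  have "card {x, xor x d} = 2" for x :: nat using xor_eq_self_iff[of x d] assms by auto
  moreover obtain x y z where "p = (x, y, z)" by (cases p)
  ultimately show ?thesis by (simp only: shift_cube.simps card_cartesian_product)
qed

lemma shift_cube_subset_grid:
  assumes "p \<in> grid (2 ^ e)" "d < 2 ^ e"
  shows "shift_cube d p \<subseteq> grid (2 ^ e)"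
  using assms by (cases p) (auto simp: grid_def xor_less_pow2)

lemma finite_grid: "finite (grid m)"
  by (simp add: grid_def)

lemma card_grid: "card (grid m) = m ^ 3"
  by (simp add: grid_def card_cartesian_product power3_eq_cube)

lemma finite_perturbations: "finite (perturbations m j)"
proof (rule finite_subset)
  show "perturbations m j \<subseteq> {d. \<forall>p. (p \<in> grid m \<longrightarrow> d p \<in> {..<m}) \<and> (p \<notin> grid m \<longrightarrow> d p = 0)}"
    by (auto simp: perturbations_def supp_def)
  show "finite {d :: nat \<times> nat \<times> nat \<Rightarrow> nat. \<forall>p. (p \<in> grid m \<longrightarrow> d p \<in> {..<m}) \<and> (p \<notin> grid m \<longrightarrow> d p = 0)}"
    by (intro finite_set_of_finite_funs finite_grid) simp
qed

text \<open>Off the support the shift is 0 and the cube is a single point.\<close>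

lemma perturbations_shift:
  assumes "d \<in> perturbations m j" "q \<in> shift_cube (d p) p"
  shows "d q = d p"
proof (cases "d p = 0")
  case True
  then have "q = p" using assms(2) by (cases p) simp
  then show ?thesis by simp
next
  case False
  then have "p \<in> supp d" by (simp add: supp_def)
  then show ?thesis using assms unfolding perturbations_def by blast
qed

text \<open>Moving a coordinate by its own shift stays in the cube where \<open>d\<close> is
  constant, so the image reveals the shift. Equal images thus have equal shifts, which cancel. The
  argument is the same on each axis.\<close>

lemma latin_cube_perturbation:
  assumes d: "d \<in> perturbations (2 ^ e) j"
  shows "latin_cube (2 ^ e) (\<lambda>x y z. xor (xor3 x y z) (d (x, y, z)))" (is "latin_cube ?m ?f")
  unfolding latin_cube_def
proof (intro conjI allI impI)
  fix x y z :: nat assume "x < ?m" "y < ?m" "z < ?m"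
  then show "?f x y z < ?m"
    using d by (intro xor_less_pow2 xor3_less_pow2) (simp_all add: perturbations_def)
next
  have *: "x = x' \<and> d (x, y, z) = d (x', y, z)"
    if "xor x (d (x, y, z)) = xor x' (d (x', y, z))" for x x' y z
  proof -
    have "d (xor x (d (x, y, z)), y, z) = d (x, y, z)" for x by (rule perturbations_shift[OF d]) simp
    then have "d (x, y, z) = d (x', y, z)" using that by metis
    then show ?thesis using that by (metis xor_cancel_right)
  qed
  fix y z :: nat
  show "inj_on (\<lambda>x. ?f x y z) {..<?m}"
  proof (rule inj_onI)
    fix x x' assume "?f x y z = ?f x' y z"
    then have "xor (xor x (d (x, y, z))) (xor y z) = xor (xor x' (d (x', y, z))) (xor y z)"
      by (simp add: xor3_def ac_simps)
    then show "x = x'" using * by (metis xor_cancel_right)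
  qed
next
  have *: "y = y' \<and> d (x, y, z) = d (x, y', z)"
    if "xor y (d (x, y, z)) = xor y' (d (x, y', z))" for x y y' z
  proof -
    have "d (x, xor y (d (x, y, z)), z) = d (x, y, z)" for y by (rule perturbations_shift[OF d]) simp
    then have "d (x, y, z) = d (x, y', z)" using that by metis
    then show ?thesis using that by (metis xor_cancel_right)
  qed
  fix x z :: nat
  show "inj_on (\<lambda>y. ?f x y z) {..<?m}"
  proof (rule inj_onI)
    fix y y' assume "?f x y z = ?f x y' z"
    then have "xor (xor y (d (x, y, z))) (xor x z) = xor (xor y' (d (x, y', z))) (xor x z)"
      by (simp add: xor3_def ac_simps)
    then show "y = y'" using * by (metis xor_cancel_right)
  qed
next
  have *: "z = z' \<and> d (x, y, z) = d (x, y, z')"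
    if "xor z (d (x, y, z)) = xor z' (d (x, y, z'))" for x y z z'
  proof -
    have "d (x, y, xor z (d (x, y, z))) = d (x, y, z)" for z by (rule perturbations_shift[OF d]) simp
    then have "d (x, y, z) = d (x, y, z')" using that by metis
    then show ?thesis using that by (metis xor_cancel_right)
  qed
  fix x y :: nat
  show "inj_on (\<lambda>z. ?f x y z) {..<?m}"
  proof (rule inj_onI)
    fix z z' assume "?f x y z = ?f x y z'"
    then have "xor (xor z (d (x, y, z))) (xor x y) = xor (xor z' (d (x, y, z'))) (xor x y)"
      by (simp add: xor3_def ac_simps)
    then show "z = z'" using * by (metis xor_cancel_right)
  qed
qed

section \<open>Adding one more cube and counting\<close>

definition add_cube :: "nat \<Rightarrow> nat \<times> nat \<times> nat \<Rightarrow> (nat \<times> nat \<times> nat \<Rightarrow> nat) \<Rightarrow> nat \<times> nat \<times> nat \<Rightarrow> nat" where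
  "add_cube c p d = (\<lambda>q. if q \<in> shift_cube c p then c else d q)"

lemma supp_add_cube: "c \<noteq> 0 \<Longrightarrow> supp (add_cube c p d) = supp d \<union> shift_cube c p"
  by (auto simp: supp_def add_cube_def)

text \<open>Cubes of \<open>d\<close> through its support stay in that support, so they miss the new
  cube; within the new cube, \<open>shift_cube_eq\<close> gives constancy.\<close>

lemma add_cube_perturbation:
  assumes d: "d \<in> perturbations (2 ^ e) j" and p: "p \<in> grid (2 ^ e)" and c: "0 < c" "c < 2 ^ e"
    and disj: "shift_cube c p \<inter> supp d = {}"
  shows "add_cube c p d \<in> perturbations (2 ^ e) (Suc j)"
proof -
  have sg: "supp d \<subseteq> grid (2 ^ e)" and cd: "card (supp d) = 8 * j" and lt: "\<And>p. d p < 2 ^ e"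
    using d unfolding perturbations_def by blast+
  have "card (supp d \<union> shift_cube c p) = card (supp d) + card (shift_cube c p)"
    by (rule card_Un_disjoint)
      (use disj finite_subset[OF sg finite_grid] in \<open>auto simp: finite_shift_cube\<close>)
  then have card: "card (supp (add_cube c p d)) = 8 * Suc j"
    using c cd card_shift_cube[of c p] by (simp add: supp_add_cube)
  have "add_cube c p d r = add_cube c p d q"
    if q: "q \<in> supp (add_cube c p d)" and r: "r \<in> shift_cube (add_cube c p d q) q" for q r
  proof (cases "q \<in> shift_cube c p")
    case True
    then have "r \<in> shift_cube c p" using r shift_cube_eq by (auto simp: add_cube_def)
    then show ?thesis using True by (simp add: add_cube_def)
  next
    case False
    then have dq: "add_cube c p d q = d q" by (simp add: add_cube_def)
    then have "d r = d q" using perturbations_shift[OF d] r by simp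
    moreover have "d q \<noteq> 0" using q dq by (simp add: supp_def)
    ultimately have "r \<notin> shift_cube c p" using disj by (auto simp: supp_def)
    then show ?thesis using dq \<open>d r = d q\<close> by (simp add: add_cube_def)
  qed
  moreover have "supp (add_cube c p d) \<subseteq> grid (2 ^ e)"
    using c sg shift_cube_subset_grid[OF p c(2)] by (simp add: supp_add_cube)
  moreover have "add_cube c p d q < 2 ^ e" for q using lt c by (simp add: add_cube_def)
  ultimately show ?thesis using card unfolding perturbations_def by blast
qed

text \<open>By symmetry, a bad \<open>p\<close> lies in the cube around one of the
  \<open>8 * j\<close> support points, and each such cube has 8 points.\<close>

lemma card_disjoint_cubes:
  assumes d: "d \<in> perturbations m j" and c: "c \<noteq> 0"
  shows "m ^ 3 - 64 * j \<le> card {p \<in> grid m. shift_cube c p \<inter> supp d = {}}"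
proof -
  have fin: "finite (supp d)" and cd: "card (supp d) = 8 * j"
    using d finite_subset[OF _ finite_grid] by (auto simp: perturbations_def)
  let ?U = "\<Union>q\<in>supp d. shift_cube c q"
  have "card ?U \<le> (\<Sum>q\<in>supp d. card (shift_cube c q))" by (rule card_UN_le[OF fin])
  also have "\<dots> = 64 * j" using cd c by (simp add: card_shift_cube)
  finally have "card ?U \<le> 64 * j" .
  moreover have "card (grid m) - card ?U \<le> card (grid m - ?U)"
    by (rule diff_card_le_card_Diff) (use fin finite_shift_cube in auto)
  moreover have "grid m - ?U \<subseteq> {p \<in> grid m. shift_cube c p \<inter> supp d = {}}"
    using shift_cube_sym by blast
  then have "card (grid m - ?U) \<le> card {p \<in> grid m. shift_cube c p \<inter> supp d = {}}"
    by (rule card_mono[rotated]) (simp add: finite_grid)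
  ultimately show ?thesis by (simp add: card_grid)
qed

text \<open>
  Double counting: a perturbation with one more cube is reached from at most \<open>8 * Suc j\<close>
  choices, since its new cube and the value there are determined by a point of the support.
\<close>

lemma card_perturbations_step:
  fixes e j :: nat
  defines "m \<equiv> 2 ^ e"
  shows "card (perturbations m j) * ((m - 1) * (m ^ 3 - 64 * j)) \<le> card (perturbations m (Suc j)) * (8 * Suc j)"
proof -
  \<comment> \<open>\<open>I\<close> lists the choices of a perturbation, a nonzero constant and an
    anchor of a new cube; \<open>J\<close> lists perturbations with a marked support point. \<Phi>
    marks the anchor.\<close>
  define I where "I = (SIGMA d:perturbations m j. SIGMA c:{1..<m}. {p \<in> grid m. shift_cube c p \<inter> supp d = {}})"
  define J where "J = (SIGMA d:perturbations m (Suc j). supp d)"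
  define \<Phi> where "\<Phi> = (\<lambda>(d, c, p). (add_cube c p d, p))"
  have finS: "finite (supp d)" if "d \<in> perturbations m i" for d i
    using that finite_subset[OF _ finite_grid] by (auto simp: perturbations_def)
  have finJ: "finite J" unfolding J_def by (intro finite_SigmaI finite_perturbations finS)
  have "card J = (\<Sum>d\<in>perturbations m (Suc j). card (supp d))"
    unfolding J_def by (rule card_SigmaI) (use finite_perturbations finS in auto)
  also have "\<dots> = (\<Sum>d\<in>perturbations m (Suc j). 8 * Suc j)"
    by (rule sum.cong) (simp_all add: perturbations_def)
  also have "\<dots> = card (perturbations m (Suc j)) * (8 * Suc j)" by simp
  finally have cardJ: "card J = card (perturbations m (Suc j)) * (8 * Suc j)" .
  have fin1: "finite (SIGMA c:{1..<m}. {p \<in> grid m. shift_cube c p \<inter> supp d = {}})" for d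
    by (intro finite_SigmaI) (simp_all add: finite_grid)
  have "(m - 1) * (m ^ 3 - 64 * j) \<le> card (SIGMA c:{1..<m}. {p \<in> grid m. shift_cube c p \<inter> supp d = {}})"
    if d: "d \<in> perturbations m j" for d
  proof -
    have "(m - 1) * (m ^ 3 - 64 * j) = (\<Sum>c\<in>{1..<m}. m ^ 3 - 64 * j)" by simp
    also have "\<dots> \<le> (\<Sum>c\<in>{1..<m}. card {p \<in> grid m. shift_cube c p \<inter> supp d = {}})"
      by (rule sum_mono) (rule card_disjoint_cubes[OF d], simp)
    also have "\<dots> = card (SIGMA c:{1..<m}. {p \<in> grid m. shift_cube c p \<inter> supp d = {}})"
      by (rule card_SigmaI[symmetric]) (simp_all add: finite_grid)
    finally show ?thesis .
  qed
  then have "(\<Sum>d\<in>perturbations m j. (m - 1) * (m ^ 3 - 64 * j)) \<le>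
    (\<Sum>d\<in>perturbations m j. card (SIGMA c:{1..<m}. {p \<in> grid m. shift_cube c p \<inter> supp d = {}}))"
    by (rule sum_mono)
  also have "\<dots> = card I" unfolding I_def
    by (rule card_SigmaI[symmetric]) (use finite_perturbations fin1 in auto)
  finally have cardI: "card (perturbations m j) * ((m - 1) * (m ^ 3 - 64 * j)) \<le> card I" by simp
  have "\<Phi> ` I \<subseteq> J"
  proof
    fix w assume "w \<in> \<Phi> ` I"
    then obtain d c p where w: "w = (add_cube c p d, p)" and d: "d \<in> perturbations m j"
      and c: "0 < c" "c < m" and p: "p \<in> grid m" "shift_cube c p \<inter> supp d = {}"
      unfolding I_def \<Phi>_def by auto
    have "add_cube c p d \<in> perturbations m (Suc j)"
      using add_cube_perturbation d c p unfolding m_def by blast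
    moreover have "p \<in> supp (add_cube c p d)" using c shift_cube_self by (simp add: supp_add_cube)
    ultimately show "w \<in> J" unfolding J_def w by simp
  qed
  moreover have "inj_on \<Phi> I"
  proof (rule inj_onI)
    fix u w assume uw: "u \<in> I" "w \<in> I" "\<Phi> u = \<Phi> w"
    obtain d c p where u: "u = (d, c, p)" and dcp: "shift_cube c p \<inter> supp d = {}"
      using uw(1) unfolding I_def by auto
    obtain d' c' p' where w: "w = (d', c', p')" and dcp': "shift_cube c' p' \<inter> supp d' = {}"
      using uw(2) unfolding I_def by auto
    have "add_cube c p d = add_cube c' p' d' \<and> p = p'"
      using uw(3) unfolding u w \<Phi>_def prod.case prod.inject .
    then have eq: "add_cube c p d = add_cube c' p' d'" and pp: "p = p'" by blast+
    \<comment> \<open>The value at the anchor returns the constant and hence the cube; on the cube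
      \<open>d\<close> was 0, elsewhere it is unchanged.\<close>
    have "add_cube c p d p = c" "add_cube c' p' d' p = c'"
      using shift_cube_self pp by (simp_all add: add_cube_def)
    then have cc: "c = c'" using eq by simp
    have "d q = d' q" for q
    proof (cases "q \<in> shift_cube c p")
      case True
      then have "q \<notin> supp d" "q \<notin> supp d'" using dcp dcp' cc pp by auto
      then show ?thesis by (simp add: supp_def)
    next
      case False
      then show ?thesis using fun_cong[OF eq, of q] cc pp by (simp add: add_cube_def)
    qed
    then show "u = w" using cc pp u w by auto
  qed
  ultimately have "card I \<le> card J" using card_inj_on_le finJ by blast
  then show ?thesis using cardI cardJ by linarith
qed

text \<open>Each step gains a factor of at least \<open>m\<close>: the hypothesis for
  \<open>Suc j\<close> gives \<open>64 * Suc j <= m ^ 3 - 64 * j\<close>, and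
  \<open>m <= 8 * (m - 1)\<close>.\<close>

lemma card_perturbations_ge:
  fixes e j :: nat
  defines "m \<equiv> 2 ^ e"
  assumes "128 * j \<le> m ^ 3"
  shows "m ^ j \<le> card (perturbations m j)"
  using assms(2)
proof (induction j)
  case 0
  have "(\<lambda>_. 0) \<in> perturbations m 0" by (simp add: perturbations_def supp_def m_def)
  then have "card (perturbations m 0) \<noteq> 0" using finite_perturbations[of m 0] by auto
  then show ?case by simp
next
  case (Suc j)
  have "m \<ge> 2"
  proof (rule ccontr)
    assume "\<not> m \<ge> 2"
    then have "m ^ 3 \<le> 1 ^ 3" by (intro power_mono) simp_all
    then show False using Suc.prems by simp
  qed
  then have "m \<le> 8 * (m - 1)" by simp
  then have "m * (8 * Suc j) \<le> 8 * (m - 1) * (8 * Suc j)" by (rule mult_right_mono) simp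
  also have "\<dots> = (m - 1) * (64 * Suc j)" by simp
  also have "\<dots> \<le> (m - 1) * (m ^ 3 - 64 * j)" by (rule mult_left_mono) (use Suc.prems in simp_all)
  finally have *: "m * (8 * Suc j) \<le> (m - 1) * (m ^ 3 - 64 * j)" .
  have "m ^ Suc j * (8 * Suc j) = m ^ j * (m * (8 * Suc j))" by simp
  also have "\<dots> \<le> card (perturbations m j) * ((m - 1) * (m ^ 3 - 64 * j))"
    by (rule mult_le_mono[OF _ *]) (use Suc in simp)
  also have "\<dots> \<le> card (perturbations m (Suc j)) * (8 * Suc j)"
    unfolding m_def by (rule card_perturbations_step)
  finally show ?case by (simp del: mult_Suc_right)
qed

subsection \<open>The lower bound\<close>

lemma latin_cube_xor3: "latin_cube (2 ^ e) xor3"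
proof -
  have "(\<lambda>_. 0) \<in> perturbations (2 ^ e) 0" by (simp add: perturbations_def supp_def)
  from latin_cube_perturbation[OF this] show ?thesis by simp
qed

text \<open>Substitute each perturbed cube for \<open>xor3\<close>. The design determines its cube,
  the cube determines \<open>d\<close> on the grid, and \<open>d\<close> vanishes elsewhere.\<close>

lemma num_S3_46_ge:
  assumes B: "xor_design v (2 ^ e) B" and j: "128 * j \<le> (2 ^ e) ^ 3"
  shows "(2 ^ e) ^ j \<le> num_S3_46 v"
proof -
  define m :: nat where "m = 2 ^ e"
  define f where "f d = (\<lambda>x y z. xor (xor3 x y z) (d (x, y, z)))" for d :: "nat \<times> nat \<times> nat \<Rightarrow> nat"
  define D where "D d = B - quads m xor3 \<union> quads m (f d)" for d
  have S: "is_S3_46 {0..<v} B" and v: "4 * m \<le> v" and quB: "quads m xor3 \<subseteq> B"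
    using B by (auto simp: xor_design_def m_def quads_def)
  have latin: "latin_cube m (f d)" if "d \<in> perturbations m j" for d
    using latin_cube_perturbation that unfolding m_def f_def by blast
  have design: "is_S3_46 {0..<v} (D d)" if "d \<in> perturbations m j" for d
    unfolding D_def
    using is_S3_46_switch[OF S v _ latin[OF that] quB] latin_cube_xor3 unfolding m_def by blast
  have "inj_on D (perturbations m j)"
  proof (rule inj_onI)
    fix d d' assume d: "d \<in> perturbations m j" and d': "d' \<in> perturbations m j" and eq: "D d = D d'"
    have "quads m (f d) \<subseteq> D d" "quads m (f d') \<subseteq> D d'" by (simp_all add: D_def)
    then have sub: "quads m (f d) \<subseteq> D d" "quads m (f d') \<subseteq> D d" by (simp_all add: eq)
    have "d p = d' p" for p
    proof (cases "p \<in> grid m")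
      case True
      then obtain x y z where p: "p = (x, y, z)" and xyz: "x < m" "y < m" "z < m"
        by (cases p) (auto simp: grid_def)
      have "f d x y z = f d' x y z"
        by (rule quads_determined[OF design[OF d] v sub latin[OF d] latin[OF d'] xyz])
      then have "xor (xor3 x y z) (xor (xor3 x y z) (d p)) = xor (xor3 x y z) (xor (xor3 x y z) (d' p))"
        by (simp add: f_def p)
      then show ?thesis by (simp flip: xor.assoc)
    next
      case False
      then have "p \<notin> supp d" "p \<notin> supp d'" using d d' unfolding perturbations_def by blast+
      then show ?thesis by (simp add: supp_def)
    qed
    then show "d = d'" by blast
  qed
  moreover have "D ` perturbations m j \<subseteq> {B. is_S3_46 {0..<v} B}" using design by blast
  \<comment> \<open>Without finiteness the cardinality would be 0 by convention.\<close>
  moreover have "finite {B. is_S3_46 {0..<v} B}"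
    by (rule finite_subset[of _ "Pow (Pow {0..<v})"]) (auto simp: is_S3_46_def)
  ultimately have "card (perturbations m j) \<le> num_S3_46 v"
    unfolding num_S3_46_def by (rule card_inj_on_le)
  moreover have "m ^ j \<le> card (perturbations m j)"
    using card_perturbations_ge j unfolding m_def by blast
  ultimately show ?thesis unfolding m_def by linarith
qed

lemma ln_num_S3_46_gt:
  assumes n: "42 \<le> n"
  shows "ln (real (num_S3_46 (2 * n))) > 1 / 200000 * real n ^ 3 * ln (real n)"
proof -
  obtain e B where B: "xor_design (2 * n) (2 ^ e) B" using ex_xor_design[of "2 * n"] n by auto
  define m :: nat where "m = 2 ^ e"
  define j where "j = m ^ 3 div 128"
  have nm: "n \<le> 6 * m" using B by (simp add: xor_design_def m_def)
  then have m7: "7 \<le> m" using n by linarith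
  have "128 * j \<le> m ^ 3" by (simp add: j_def)
  then have "m ^ j \<le> num_S3_46 (2 * n)" using num_S3_46_ge[OF B] unfolding m_def by blast
  then have "real m ^ j \<le> real (num_S3_46 (2 * n))" by (metis of_nat_le_iff of_nat_power)
  moreover have mpos: "0 < real m ^ j" using m7 by simp
  ultimately have "ln (real m ^ j) \<le> ln (real (num_S3_46 (2 * n)))"
    by (intro ln_mono)
  then have lnN: "real j * ln (real m) \<le> ln (real (num_S3_46 (2 * n)))"
    using m7 by (simp add: ln_realpow)
  have m3: "(7::nat) ^ 3 \<le> m ^ 3" using m7 by (intro power_mono) simp_all
  have "m ^ 3 < 128 * j + 128" unfolding j_def by presburger
  \<comment> \<open>Here \<open>j\<close> is positive, so rounding down costs at most a factor
    2.\<close>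
  then have "m ^ 3 \<le> 256 * j" using m3 by simp
  then have "real (m ^ 3) \<le> real (256 * j)" by (simp only: of_nat_le_iff)
  then have j: "real m ^ 3 / 256 \<le> real j" by simp
  have "real n / 6 \<le> real m" using nm by simp
  then have "(real n / 6) ^ 3 \<le> real m ^ 3" by (intro power_mono) simp_all
  then have j': "real n ^ 3 / 55296 \<le> real j" using j by (simp add: power_divide)
  \<comment> \<open>As \<open>n\<close> is at least 36, passing from \<open>n\<close> to
    \<open>n / 6\<close> costs at most a factor 2 in the logarithm.\<close>
  have "ln (real n) \<le> ln ((real n / 6)\<^sup>2)"
  proof (subst ln_le_cancel_iff)
    have "real n * 36 \<le> real n * real n" using n by (intro mult_left_mono) simp_all
    then show "real n \<le> (real n / 6)\<^sup>2" by (simp add: power2_eq_square)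
  qed (use n in simp_all)
  also have "\<dots> = 2 * ln (real n / 6)" using n by (simp add: ln_realpow)
  also have "\<dots> \<le> 2 * ln (real m)" using \<open>real n / 6 \<le> real m\<close> n m7 by simp
  finally have lnm: "ln (real n) / 2 \<le> ln (real m)" by simp
  have lnpos: "0 < ln (real n)" using n by simp
  \<comment> \<open>\<open>110592 = 2 * 6 ^ 3 * 256\<close> collects the losses; the larger
    denominator makes the inequality strict.\<close>
  have "1 / 200000 * real n ^ 3 * ln (real n) < 1 / 110592 * real n ^ 3 * ln (real n)"
    using lnpos n by simp
  also have "\<dots> = (real n ^ 3 / 55296) * (ln (real n) / 2)" by simp
  also have "\<dots> \<le> real j * ln (real m)" using j' lnm lnpos by (intro mult_mono) simp_all
  also note lnN
  finally show ?thesis .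
qed

theorem theorem3:
  shows "\<exists>c::real. c > 0 \<and>
    (\<forall>\<^sub>F n in sequentially. ln (real (num_S3_46 (2 * n))) > c * real n ^ 3 * ln (real n))"
proof (intro exI conjI)
  show "\<forall>\<^sub>F n in sequentially.
      ln (real (num_S3_46 (2 * n))) > 1 / 200000 * real n ^ 3 * ln (real n)"
    using ln_num_S3_46_gt by (rule eventually_sequentiallyI)
qed simp

end
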